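(* Let $B$ be a real Banach space and $P$ a set of representatives for $\mathfrak{F}_B$. Suppose that $$M_{p,\alpha}=\{a\in S(B):p(a)=\alpha\}$$ for every $p\in P$ and every real $\alpha$ with $-1\le\alpha\le1$. Then $B$ has the Mazur-Ulam property.
   Context: $S(B)$ is the unit sphere of $B$, $\operatorname{Ball}(B^* )$ the closed unit ball of the dual, and $\mathbb{T}=\{\pm1\}$ since $B$ is real. $\mathfrak{F}_B$ is the set of all maximal convex subsets of $S(B)$. Let $Q$ be the set of extreme points $q$ of $\operatorname{Ball}(B^* )$ such that $q^{-1}(1)\cap S(B)\in\mathfrak{F}_B$. For $p_1,p_2\in Q$ write $p_1\sim p_2$ if there is $\gamma\in\mathbb{T}$ with $p_1^{-1}(1)\cap S(B)=(\gamma p_2)^{-1}(1)\cap S(B)$; this is an equivalence relation on $Q$. A set of representatives for $\mathfrak{F}_B$ is a subset $P\subset Q$ containing exactly one element of each $\sim$-class. For $p\in P$ and $\lambda\in\mathbb{T}$ put $F_{p,\lambda}=\{a\in S(B):p(a)=\lambda\}$. For $p\in P$ and $\alpha\in[-1,1]$ put $$M_{p,\alpha}=\{a\in S(B): d(a,F_{p,\alpha/|\alpha|})\le 1-|\alpha|,\ d(a,F_{p,-\alpha/|\alpha|})\le 1+|\alpha|\},$$ where $\alpha/|\alpha|$ is read as $1$ if $\alpha=0$ and $d$ denotes the distance from a point to a set. A real Banach space $B$ has the Mazur-Ulam property if for any real Banach space $B'$, every surjective isometry from $S(B)$ onto $S(B')$ admits an extension to a surjective real-linear isometry from $B$ onto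 $B'$. *)

theory Defs
  imports "HOL-Analysis.Analysis"
begin

text \<open>A real Banach space is a type of class \<^class>\<open>banach\<close>, its dual is the type of bounded linear
  functionals \<open>'a \<Rightarrow>\<^sub>L real\<close> with the operator norm, and \<open>S(B)\<close> is \<open>sphere 0 1\<close>.\<close>

definition maximal_convex_subsets :: "'a::banach set set"
  where "maximal_convex_subsets =
    {F. F \<subseteq> sphere 0 1 \<and> convex F \<and>
        (\<forall>G. G \<subseteq> sphere 0 1 \<and> convex G \<and> F \<subseteq> G \<longrightarrow> G = F)}"

definition level_set :: "('a::banach \<Rightarrow>\<^sub>L real) \<Rightarrow> real \<Rightarrow> 'a set"
  where "level_set p c = {a \<in> sphere 0 1. blinfun_apply p a = c}"

definition Q_set :: "('a::banach \<Rightarrow>\<^sub>L real) set"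
  where "Q_set = {q. q extreme_point_of (cball 0 1) \<and> level_set q 1 \<in> maximal_convex_subsets}"

definition Q_rel :: "(('a::banach \<Rightarrow>\<^sub>L real) \<times> ('a \<Rightarrow>\<^sub>L real)) set"
  where "Q_rel = {(p1, p2). p1 \<in> Q_set \<and> p2 \<in> Q_set \<and>
    (\<exists>\<gamma>\<in>{1, -1}. level_set p1 1 = level_set (\<gamma> *\<^sub>R p2) 1)}"

lemma equiv_Q_rel: "equiv Q_set Q_rel"
proof -
  have neg: "level_set (- p) 1 = uminus ` level_set p 1" for p :: "'a::banach \<Rightarrow>\<^sub>L real"
  proof -
    have "a \<in> uminus ` level_set p 1" if "a \<in> level_set (- p) 1" for a
      using that by (intro image_eqI[of _ _ "- a"])
        (auto simp: level_set_def uminus_blinfun.rep_eq blinfun.minus_right)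
    then show ?thesis
      by (auto simp: level_set_def uminus_blinfun.rep_eq blinfun.minus_right)
  qed
  show ?thesis
    by (rule equivI)
       (auto simp: Q_rel_def refl_on_def sym_def trans_def neg image_image)
qed

definition representatives :: "('a::banach \<Rightarrow>\<^sub>L real) set \<Rightarrow> bool"
  where "representatives P \<longleftrightarrow> P \<subseteq> Q_set \<and> (\<forall>C \<in> Q_set // Q_rel. \<exists>!p. p \<in> P \<inter> C)"

definition phase :: "real \<Rightarrow> real"
  where "phase \<alpha> = (if \<alpha> = 0 then 1 else \<alpha> / \<bar>\<alpha>\<bar>)"

text \<open>\<open>F\<^bsub>p,\<lambda>\<^esub>\<close> is \<open>level_set p \<lambda>\<close>. For \<open>p \<in> Q_set\<close> and \<open>\<lambda> = \<plusminus>1\<close> it is nonempty unless \<open>S(B)\<close> is empty, so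
  the convention \<open>infdist a {} = 0\<close> never plays a role.\<close>

definition M_set :: "('a::banach \<Rightarrow>\<^sub>L real) \<Rightarrow> real \<Rightarrow> 'a set"
  where "M_set p \<alpha> = {a \<in> sphere 0 1.
    infdist a (level_set p (phase \<alpha>)) \<le> 1 - \<bar>\<alpha>\<bar> \<and>
    infdist a (level_set p (- phase \<alpha>)) \<le> 1 + \<bar>\<alpha>\<bar>}"

text \<open>HOL cannot quantify over types inside a formula, so the target space \<open>'b\<close> is a
  parameter. Quantification over all real Banach spaces \<open>B'\<close> is expressed by leaving \<open>'b\<close> a free
  type variable in a theorem whose hypotheses do not mention it.\<close>

definition mazur_ulam_property :: "'a::banach itself \<Rightarrow> 'b::banach itself \<Rightarrow> bool"
  where "mazur_ulam_property _ _ \<longleftrightarrow>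
    (\<forall>T :: 'a \<Rightarrow> 'b.
      T ` sphere 0 1 = sphere 0 1 \<and>
      (\<forall>x \<in> sphere 0 1. \<forall>y \<in> sphere 0 1. dist (T x) (T y) = dist x y) \<longrightarrow>
      (\<exists>L :: 'a \<Rightarrow> 'b. linear L \<and> surj L \<and> (\<forall>x y. dist (L x) (L y) = dist x y) \<and>
        (\<forall>x \<in> sphere 0 1. L x = T x)))"

end

theory Submission
  imports Defs
begin

text \<open>A surjective isometry \<open>T\<close> of unit spheres turns out to be linear because enough linear
  functionals survive the transport by \<open>T\<close>.

  Every maximal convex subset of a sphere is the set \<open>q = 1\<close> for an extreme point \<open>q\<close> of the dual
  ball (\<open>extreme_supporting_functional\<close>, \<open>maximal_convex_eq_level_set\<close>). The isometry \<open>T\<close> maps maximal convex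
  sets to maximal convex sets (\<open>image_maximal_convex\<close>) and respects the passage to the opposite set
  (\<open>image_antipodal_maximal_convex\<close>). These two facts rest on the metric relation \<open>norm (a + y) = 2\<close>,
  which says that \<open>y\<close> and \<open>- a\<close> are at the largest possible distance, and on the observation that a
  maximal convex set consists of all points in this relation to each of its own points.

  Hence for \<open>p \<in> P\<close> the faces \<open>p = \<plusminus>1\<close> are carried to faces \<open>q = \<plusminus>1\<close> of the other sphere. By the hypothesis
  on \<open>M_set\<close>, a point on the level \<open>p = \<alpha>\<close> satisfies two bounds on its distances from the faces
  \<open>p = \<plusminus>1\<close>; \<open>T\<close> preserves these bounds, and in the target they force \<open>q = \<alpha>\<close>. So \<open>q \<circ> T = p\<close> on the
  sphere (\<open>transported_functional\<close>), and this persists for the positively homogeneous extension of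
  \<open>T\<close>. As each unit vector lies in some maximal convex set, the functionals \<open>q\<close>
  obtained in this way separate points (\<open>representatives_norming\<close>), and a map whose compositions with
  a separating family of functionals are all linear is linear itself. It preserves the norm and is
  surjective by construction.\<close>

section \<open>Supporting functionals that are extreme\<close>

definition sublinear :: "('a::real_vector \<Rightarrow> real) \<Rightarrow> bool"
  where "sublinear s \<longleftrightarrow>
    (\<forall>x y. s (x + y) \<le> s x + s y) \<and> (\<forall>t x. 0 \<le> t \<longrightarrow> s (t *\<^sub>R x) \<le> t * s x)"

text \<open>For a sublinear \<open>s \<le> norm\<close> the set \<open>dominated s\<close> is a weak-star closed convex subset of the dual
  ball. Sublinear functionals stand in for these sets and take over the role of weak-star compactness:
  intersecting a chain of sets becomes taking an infimum of functionals, and a functional that cannot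
  be made smaller is linear, that is, its set has a single point.\<close>

definition dominated :: "('a::real_normed_vector \<Rightarrow> real) \<Rightarrow> ('a \<Rightarrow>\<^sub>L real) set"
  where "dominated s = {f. \<forall>x. blinfun_apply f x \<le> s x}"

definition facial :: "('a::real_normed_vector \<Rightarrow> real) \<Rightarrow> bool"
  where "facial s \<longleftrightarrow> sublinear s \<and> (\<forall>x. s x \<le> norm x) \<and> dominated s face_of cball 0 1"

lemma sublinear_add: "sublinear s \<Longrightarrow> s (x + y) \<le> s x + s y"
  by (simp add: sublinear_def)

lemma sublinear_scale: "sublinear s \<Longrightarrow> 0 \<le> t \<Longrightarrow> s (t *\<^sub>R x) \<le> t * s x"
  by (simp add: sublinear_def)

lemma sublinear_zero: "sublinear s \<Longrightarrow> s 0 = 0"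
  using sublinear_add[of s 0 0] sublinear_scale[of s 0 0] by simp

lemma sublinear_neg: "sublinear s \<Longrightarrow> - s (- x) \<le> s x"
  using sublinear_add[of s x "- x"] sublinear_zero[of s] by simp

lemma facial_lower: "facial s \<Longrightarrow> - norm x \<le> s x"
  using sublinear_neg[of s x] unfolding facial_def
  by (metis neg_le_iff_le norm_minus_cancel order_trans)

text \<open>An infimum of a family is sublinear as soon as the two defining inequalities can be met by choosing a
  suitable member of the family. This covers both infima below, over a chain and over the cone
  spanned by a convex set.\<close>

lemma sublinear_INF:
  fixes g :: "'i \<Rightarrow> 'a::real_vector \<Rightarrow> real"
  assumes I: "I \<noteq> {}" and bdd: "\<And>x. bdd_below ((\<lambda>i. g i x) ` I)"
    and add: "\<And>i j x y. i \<in> I \<Longrightarrow> j \<in> I \<Longrightarrow> \<exists>k\<in>I. g k (x + y) \<le> g i x + g j y"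
    and scale: "\<And>i t x. i \<in> I \<Longrightarrow> 0 \<le> t \<Longrightarrow> \<exists>k\<in>I. g k (t *\<^sub>R x) \<le> t * g i x"
  shows "sublinear (\<lambda>x. INF i\<in>I. g i x)"
proof -
  let ?s = "\<lambda>x. INF i\<in>I. g i x"
  have low: "?s x \<le> g i x" if "i \<in> I" for i x
    using cINF_lower[OF bdd that] .
  have 1: "?s (x + y) \<le> ?s x + ?s y" for x y
  proof -
    have *: "?s (x + y) \<le> g i x + g j y" if "i \<in> I" "j \<in> I" for i j
      using add[OF that, of x y] low order_trans by blast
    have "?s (x + y) - g i x \<le> ?s y" if "i \<in> I" for i
      using *[OF that] by (intro cINF_greatest I) (simp add: algebra_simps)
    then have "?s (x + y) - ?s y \<le> g i x" if "i \<in> I" for i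
      using that by (simp add: algebra_simps)
    then have "?s (x + y) - ?s y \<le> ?s x"
      by (intro cINF_greatest I)
    then show ?thesis by simp
  qed
  have 2: "?s (t *\<^sub>R x) \<le> t * ?s x" if t: "0 \<le> t" for t x
  proof -
    have *: "?s (t *\<^sub>R x) \<le> t * g i x" if "i \<in> I" for i
      using scale[OF that t, of x] low order_trans by blast
    show ?thesis
    proof (cases "t = 0")
      case True
      then show ?thesis using * I by fastforce
    next
      case False
      with t have "t > 0" by simp
      then have "?s (t *\<^sub>R x) / t \<le> ?s x"
        using * by (intro cINF_greatest I) (simp add: field_simps)
      then show ?thesis using \<open>t > 0\<close> by (simp add: field_simps)
    qed
  qed
  show ?thesis unfolding sublinear_def using 1 2 by blast
qed

lemma dominated_norm: "dominated norm = (cball 0 1 :: ('a::real_normed_vector \<Rightarrow>\<^sub>L real) set)"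
proof (intro set_eqI iffI)
  fix f :: "'a \<Rightarrow>\<^sub>L real"
  assume f: "f \<in> dominated norm"
  have "norm (blinfun_apply f x) \<le> norm x" for x
    using f[unfolded dominated_def mem_Collect_eq, rule_format, of x]
      f[unfolded dominated_def mem_Collect_eq, rule_format, of "- x"]
    by (simp add: blinfun.minus_right abs_le_iff)
  then have "norm f \<le> 1" by (intro norm_blinfun_bound) auto
  then show "f \<in> cball 0 1" by simp
next
  fix f :: "'a \<Rightarrow>\<^sub>L real"
  assume "f \<in> cball 0 1"
  then have "norm f \<le> 1" by simp
  then have "norm (blinfun_apply f x) \<le> norm x" for x
    using norm_blinfun[of f x] mult_right_mono[of "norm f" 1 "norm x"] by simp
  then show "f \<in> dominated norm" by (auto simp: dominated_def abs_le_iff)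
qed

lemma facial_norm: "facial norm"
  by (auto simp: facial_def sublinear_def norm_triangle_ineq dominated_norm face_of_refl)

text \<open>The infimum is finite because every member is bounded below by \<open>- norm\<close>, and its dominated
  functionals are the intersection of the faces that belong to the members, hence again a face.\<close>

lemma facial_chain_INF:
  fixes C :: "('a::real_normed_vector \<Rightarrow> real) set"
  assumes C: "C \<noteq> {}" and fac: "\<And>s. s \<in> C \<Longrightarrow> facial s"
    and chain: "\<And>s t. s \<in> C \<Longrightarrow> t \<in> C \<Longrightarrow> s \<le> t \<or> t \<le> s"
  shows "facial (\<lambda>x. INF s\<in>C. s x)" (is "facial ?u")
proof -
  have bdd: "bdd_below ((\<lambda>s. s x) ` C)" for x
    using fac facial_lower by (intro bdd_belowI2[of _ "- norm x"]) blast
  have low: "?u x \<le> s x" if "s \<in> C" for s x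
    using cINF_lower[OF bdd that] .
  have sub: "sublinear ?u"
  proof (rule sublinear_INF[OF C bdd])
    fix s t x y assume st: "s \<in> C" "t \<in> C"
    have "\<exists>k\<in>C. k \<le> s \<and> k \<le> t" using chain[OF st] st by blast
    then obtain k where k: "k \<in> C" "k \<le> s" "k \<le> t" by blast
    have "k (x + y) \<le> k x + k y" using fac[OF k(1)] sublinear_add by (auto simp: facial_def)
    also have "\<dots> \<le> s x + t y" using k by (simp add: le_fun_def add_mono)
    finally show "\<exists>k\<in>C. k (x + y) \<le> s x + t y" using k(1) by blast
  next
    fix s x and t :: real assume "s \<in> C" "0 \<le> t"
    then show "\<exists>k\<in>C. k (t *\<^sub>R x) \<le> t * s x"
      using fac[of s] sublinear_scale[of s t x] by (auto simp: facial_def)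
  qed
  have "dominated ?u = \<Inter> (dominated ` C)"
    unfolding dominated_def using low order_trans
    by (auto intro!: cINF_greatest C) blast
  moreover have "\<Inter> (dominated ` C) face_of cball 0 1"
    using C fac by (intro face_of_Inter) (auto simp: facial_def)
  moreover have "?u x \<le> norm x" for x
    using C fac low[of _ x] order_trans unfolding facial_def by blast
  ultimately show ?thesis using sub by (simp add: facial_def)
qed

text \<open>Cutting down to the functionals that attain the value \<open>c\<close> everywhere on \<open>F\<close>. The condition
  \<open>f \<le> s\<close> together with \<open>f = c\<close> on \<open>F\<close> forces \<open>f x = f (x + t a) - t c \<le> s (x + t a) - t c\<close>, and
  the infimum of these bounds is the new functional. It is facial because a proper convex
  combination of numbers \<open>\<le> c\<close> equals \<open>c\<close> only if both numbers do. With \<open>s = norm\<close>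
  it yields the functionals supporting a convex subset of the sphere; with \<open>F\<close> a
  singleton it is the step that makes a minimal functional linear.\<close>

lemma facial_tighten:
  fixes s :: "'a::real_normed_vector \<Rightarrow> real"
  assumes s: "facial s" and F: "convex F" "F \<noteq> {}" and c: "\<And>a. a \<in> F \<Longrightarrow> s a = c"
  shows "\<exists>s'. facial s' \<and> s' \<le> s \<and> (\<forall>a\<in>F. s' (- a) \<le> - c)"
proof -
  define I where "I = {0::real..} \<times> F"
  define g where "g = (\<lambda>(t, a) x. s (x + t *\<^sub>R a) - t * c)"
  define s' where "s' = (\<lambda>x. INF i\<in>I. g i x)"
  have sub: "sublinear s" using s by (simp add: facial_def)
  have I: "I \<noteq> {}" using F by (auto simp: I_def)
  have tc: "s (t *\<^sub>R a) = t * c" if "0 \<le> t" "a \<in> F" for t a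
  proof (cases "t = 0")
    case True then show ?thesis using sublinear_zero[OF sub] by simp
  next
    case False
    then have "c \<le> inverse t * s (t *\<^sub>R a)"
      using sublinear_scale[OF sub, of "inverse t" "t *\<^sub>R a"] that c by simp
    then have "t * c \<le> s (t *\<^sub>R a)" using False that by (simp add: field_simps)
    then show ?thesis using sublinear_scale[OF sub that(1), of a] that c by force
  qed
  have bdd: "bdd_below ((\<lambda>i. g i x) ` I)" for x
  proof (intro bdd_belowI2[of _ "- s (- x)"])
    fix i assume "i \<in> I"
    then obtain t a where i: "i = (t, a)" "0 \<le> t" "a \<in> F" by (auto simp: I_def)
    have "s (t *\<^sub>R a) \<le> s (x + t *\<^sub>R a) + s (- x)"
      using sublinear_add[OF sub, of "x + t *\<^sub>R a" "- x"] by simp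
    then show "- s (- x) \<le> g i x" using tc i by (simp add: g_def)
  qed
  have low: "s' x \<le> s (x + t *\<^sub>R a) - t * c" if "0 \<le> t" "a \<in> F" for t a x
    using cINF_lower[OF bdd, of "(t, a)" x] that by (simp add: s'_def I_def g_def)
  have sub': "sublinear s'"
    unfolding s'_def
  proof (rule sublinear_INF[OF I bdd])
    fix i j x y assume "i \<in> I" "j \<in> I"
    then obtain t a u b where ij: "i = (t, a)" "0 \<le> t" "a \<in> F" "j = (u, b)" "0 \<le> u" "b \<in> F"
      by (auto simp: I_def)
    \<comment> \<open>By convexity of the set, a nonnegative combination of two of its points is a multiple of a third one.\<close>
    have "\<exists>d\<in>F. (t + u) *\<^sub>R d = t *\<^sub>R a + u *\<^sub>R b"
    proof (cases "t + u = 0")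
      case True
      then have "t = 0" "u = 0" using ij by auto
      then show ?thesis using ij by auto
    next
      case False
      then have "(t / (t + u)) *\<^sub>R a + (u / (t + u)) *\<^sub>R b \<in> F"
        using ij by (intro convexD[OF F(1)]) (auto simp flip: add_divide_distrib)
      moreover have "(t + u) *\<^sub>R ((t / (t + u)) *\<^sub>R a + (u / (t + u)) *\<^sub>R b) = t *\<^sub>R a + u *\<^sub>R b"
        using False by (simp add: scaleR_add_right)
      ultimately show ?thesis by blast
    qed
    then obtain d where d: "d \<in> F" "(t + u) *\<^sub>R d = t *\<^sub>R a + u *\<^sub>R b" by blast
    have "s ((x + y) + (t + u) *\<^sub>R d) \<le> s (x + t *\<^sub>R a) + s (y + u *\<^sub>R b)"
      using sublinear_add[OF sub, of "x + t *\<^sub>R a" "y + u *\<^sub>R b"] d(2) by (simp add: algebra_simps)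
    then have "g (t + u, d) (x + y) \<le> g i x + g j y"
      using ij by (simp add: g_def algebra_simps)
    then show "\<exists>k\<in>I. g k (x + y) \<le> g i x + g j y"
      using ij d by (intro bexI[of _ "(t + u, d)"]) (auto simp: I_def)
  next
    fix i x and r :: real assume "i \<in> I" "0 \<le> r"
    then obtain t a where i: "i = (t, a)" "0 \<le> t" "a \<in> F" by (auto simp: I_def)
    have "s (r *\<^sub>R x + (r * t) *\<^sub>R a) \<le> r * s (x + t *\<^sub>R a)"
      using sublinear_scale[OF sub \<open>0 \<le> r\<close>, of "x + t *\<^sub>R a"] by (simp add: scaleR_add_right)
    then have "g (r * t, a) (r *\<^sub>R x) \<le> r * g i x"
      using i by (simp add: g_def algebra_simps)
    then show "\<exists>k\<in>I. g k (r *\<^sub>R x) \<le> r * g i x"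
      using i \<open>0 \<le> r\<close> by (intro bexI[of _ "(r * t, a)"]) (auto simp: I_def)
  qed
  obtain a0 where a0: "a0 \<in> F" using F by blast
  have le: "s' x \<le> s x" for x using low[OF order_refl a0, of x] by simp
  have neg: "s' (- a) \<le> - c" if "a \<in> F" for a
    using low[of 1 a "- a"] that sublinear_zero[OF sub] by simp
  have dom: "dominated s' = {f \<in> dominated s. \<forall>a\<in>F. blinfun_apply f a = c}"
  proof (intro set_eqI iffI)
    fix f assume "f \<in> dominated s'"
    then have f: "f x \<le> s' x" for x by (simp add: dominated_def)
    have f': "f x \<le> s x" for x using f le order_trans by blast
    have "f a = c" if "a \<in> F" for a
      using f[of "- a"] neg[OF that] f'[of a] c[OF that] by (simp add: blinfun.minus_right)
    then show "f \<in> {f \<in> dominated s. \<forall>a\<in>F. blinfun_apply f a = c}"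
      using f' by (simp add: dominated_def)
  next
    fix f assume f: "f \<in> {f \<in> dominated s. \<forall>a\<in>F. blinfun_apply f a = c}"
    have "f x \<le> g i x" if iI: "i \<in> I" for i x
    proof -
      obtain t a where i: "i = (t, a)" "0 \<le> t" "a \<in> F" using iI by (auto simp: I_def)
      have "f (x + t *\<^sub>R a) \<le> s (x + t *\<^sub>R a)" using f by (simp add: dominated_def)
      then show ?thesis using f i by (simp add: g_def blinfun.add_right blinfun.scaleR_right)
    qed
    then show "f \<in> dominated s'"
      unfolding dominated_def s'_def using I by (auto intro!: cINF_greatest)
  qed
  have cv: "convex (dominated s)" using s face_of_imp_convex by (auto simp: facial_def)
  have "dominated s' face_of dominated s"
    unfolding face_of_def
  proof (intro conjI ballI impI)
    show "dominated s' \<subseteq> dominated s" using dom by blast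
    show "convex (dominated s')"
      unfolding dom
    proof (rule convexI)
      fix f h and u v :: real
      assume *: "f \<in> {f \<in> dominated s. \<forall>a\<in>F. blinfun_apply f a = c}"
        "h \<in> {f \<in> dominated s. \<forall>a\<in>F. blinfun_apply f a = c}" "0 \<le> u" "0 \<le> v" "u + v = 1"
      then have "u *\<^sub>R f + v *\<^sub>R h \<in> dominated s" by (intro convexD[OF cv]) auto
      moreover have "u * c + v * c = c" using *(5) by (metis distrib_right mult_1)
      ultimately show "u *\<^sub>R f + v *\<^sub>R h \<in> {f \<in> dominated s. \<forall>a\<in>F. blinfun_apply f a = c}"
        using * by (auto simp: blinfun.add_left blinfun.scaleR_left)
    qed
  next
    have main: "g1 \<in> dominated s'" if gh: "g1 \<in> dominated s" "h \<in> dominated s" "f \<in> dominated s'"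
        and seg: "f \<in> open_segment g1 h" for f g1 h
    proof -
      obtain u where u: "0 < u" "u < 1" "f = (1 - u) *\<^sub>R g1 + u *\<^sub>R h"
        using seg unfolding in_segment by blast
      have "g1 a = c" if a: "a \<in> F" for a
      proof -
        have le: "g1 a \<le> c" "h a \<le> c" using gh c[OF a] by (auto simp: dominated_def)
        have "(1 - u) * g1 a + u * h a = c"
          using gh(3) a u(3) unfolding dom by (auto simp: blinfun.add_left blinfun.scaleR_left)
        moreover have "u * h a \<le> u * c" using le u by simp
        ultimately have "(1 - u) * c \<le> (1 - u) * g1 a" by (simp add: algebra_simps)
        then show ?thesis using le u by simp
      qed
      then show ?thesis using gh dom by blast
    qed
    fix g1 h f assume *: "g1 \<in> dominated s" "h \<in> dominated s" "f \<in> dominated s'"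
      "f \<in> open_segment g1 h"
    then show "g1 \<in> dominated s'" using main by blast
    from * show "h \<in> dominated s'" using main[of h g1 f] by (simp add: open_segment_commute)
  qed
  then have "dominated s' face_of cball 0 1"
    using s face_of_trans by (auto simp: facial_def)
  moreover have "s' x \<le> norm x" for x using le s order_trans unfolding facial_def by blast
  ultimately have "facial s'" using sub' by (simp add: facial_def)
  then show ?thesis using le neg by (auto simp: le_fun_def)
qed

lemma facial_minimal:
  assumes s: "facial s"
  shows "\<exists>m. facial m \<and> m \<le> s \<and> (\<forall>m'. facial m' \<longrightarrow> m' \<le> m \<longrightarrow> m' = m)"
proof -
  let ?A = "{m. facial m \<and> m \<le> s}"
  have "\<exists>m\<in>?A. \<forall>a\<in>?A. a \<le> m \<longrightarrow> a = m"
  proof (rule predicate_Zorn[where P = "\<lambda>a b. b \<le> a"])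
    show "partial_order_on ?A (relation_of (\<lambda>a b. b \<le> a) ?A)"
      by (rule partial_order_on_relation_ofI) auto
  next
    fix C assume C: "C \<in> Chains (relation_of (\<lambda>a b. b \<le> a) ?A)"
    have CA: "C \<subseteq> ?A" using Chains_relation_of[OF C] .
    show "\<exists>u\<in>?A. \<forall>a\<in>C. u \<le> a"
    proof (cases "C = {}")
      case True then show ?thesis using s by auto
    next
      case False
      have chain: "a \<le> b \<or> b \<le> a" if "a \<in> C" "b \<in> C" for a b
        using C that by (auto simp: Chains_def relation_of_def)
      have fac: "facial a" if "a \<in> C" for a using CA that by blast
      have fi: "facial (\<lambda>x. INF a\<in>C. a x)" using facial_chain_INF[OF False fac chain] .
      have bdd: "bdd_below ((\<lambda>a. a x) ` C)" for x
        using fac facial_lower by (intro bdd_belowI2[of _ "- norm x"]) blast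
      have low: "(\<lambda>x. INF a\<in>C. a x) \<le> b" if "b \<in> C" for b
        using cINF_lower[OF bdd that] by (simp add: le_fun_def)
      have "(\<lambda>x. INF a\<in>C. a x) \<le> s" using False CA low order_trans by blast
      then show ?thesis using fi low by blast
    qed
  qed
  then show ?thesis using order_trans by blast
qed

text \<open>The Hahn-Banach and Krein-Milman theorems in one stroke. Starting from the norm, tightened along
  \<open>F\<close>, take a minimal facial functional \<open>m\<close>. Tightening it further at any point \<open>x\<close>
  changes nothing, so \<open>m (- x) = - m x\<close>; thus \<open>m\<close> is linear, and the face it defines consists
  of \<open>m\<close> alone, which makes it an extreme point.\<close>

theorem extreme_supporting_functional:
  fixes F :: "'a::banach set"
  assumes F: "convex F" "F \<noteq> {}" "F \<subseteq> sphere 0 1"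
  shows "\<exists>q :: 'a \<Rightarrow>\<^sub>L real. q extreme_point_of cball 0 1 \<and> (\<forall>a\<in>F. blinfun_apply q a = 1)"
proof -
  have "\<exists>s. facial s \<and> s \<le> norm \<and> (\<forall>a\<in>F. s (- a) \<le> - 1)"
    using F by (intro facial_tighten facial_norm) auto
  then obtain s where s: "facial s" "\<forall>a\<in>F. s (- a) \<le> - 1" by blast
  obtain m where m: "facial m" "m \<le> s" and min: "\<And>m'. facial m' \<Longrightarrow> m' \<le> m \<Longrightarrow> m' = m"
    using facial_minimal[OF s(1)] by blast
  have sub: "sublinear m" and mn: "\<And>x. m x \<le> norm x" using m by (auto simp: facial_def)
  have odd: "m (- x) = - m x" for x
  proof -
    obtain m' where m': "facial m'" "m' \<le> m" "m' (- x) \<le> - m x"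
      using facial_tighten[OF m(1), of "{x}" "m x"] by auto
    then show ?thesis using min[OF m'(1,2)] sublinear_neg[OF sub, of "- x"] by simp
  qed
  have add: "m (x + y) = m x + m y" for x y
    using sublinear_add[OF sub, of x y] sublinear_add[OF sub, of "- x" "- y"] odd[of "x + y"]
    by (simp add: odd)
  have pos: "m (t *\<^sub>R x) = t * m x" if "0 \<le> t" for t x
    using sublinear_scale[OF sub that, of x] sublinear_scale[OF sub that, of "- x"]
    by (simp add: odd)
  have scale: "m (t *\<^sub>R x) = t * m x" for t x
    using pos[of t x] pos[of "- t" x] odd[of "t *\<^sub>R x"] by (cases "0 \<le> t") auto
  have "bounded_linear m"
    using add scale mn[of "- x" for x] mn
    by (intro bounded_linear_intro[where K = 1]) (auto simp: odd abs_le_iff)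
  then obtain q where q: "blinfun_apply q = m"
    using bounded_linear_Blinfun_apply by blast
  have "dominated m = {q}"
  proof (intro set_eqI iffI)
    fix f assume "f \<in> dominated m"
    then have f: "f x \<le> m x" for x by (simp add: dominated_def)
    have "f x = q x" for x
      using f[of x] f[of "- x"] by (simp add: q odd blinfun.minus_right)
    then show "f \<in> {q}" by (simp add: blinfun_eqI)
  qed (simp add: dominated_def q)
  then have "q extreme_point_of cball 0 1"
    using m(1) by (simp add: facial_def face_of_singleton)
  moreover have "q a = 1" if a: "a \<in> F" for a
  proof -
    have "m (- a) \<le> - 1" using m(2) s(2) a by (force simp: le_fun_def intro: order_trans)
    moreover have "m a \<le> 1" using mn[of a] a F by auto
    ultimately show ?thesis by (simp add: q odd)
  qed
  ultimately show ?thesis by blast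
qed


section \<open>Maximal convex subsets of the sphere\<close>

text \<open>The points lying, together with each single point of \<open>A\<close>, on a common segment of the sphere.
  As \<open>norm (a + y) = 2\<close> says that \<open>y\<close> and \<open>- a\<close> are at distance \<open>2\<close>, this notion is metric.\<close>

definition star :: "'a::real_normed_vector set \<Rightarrow> 'a set"
  where "star A = {y \<in> sphere 0 1. \<forall>a\<in>A. norm (a + y) = 2}"

definition sphere_isometry :: "('a::banach \<Rightarrow> 'b::banach) \<Rightarrow> bool"
  where "sphere_isometry T \<longleftrightarrow> T ` sphere 0 1 = sphere 0 1 \<and>
    (\<forall>x\<in>sphere 0 1. \<forall>y\<in>sphere 0 1. dist (T x) (T y) = dist x y)"

text \<open>Since distances from \<open>- a\<close> turn into norms of sums with \<open>a\<close>, an isometry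
  of spheres always appears together with this companion; that the two agree on maximal convex sets
  is a result, not a formality.\<close>

definition antipodal :: "('a::banach \<Rightarrow> 'b::banach) \<Rightarrow> 'a \<Rightarrow> 'b"
  where "antipodal T x = - T (- x)"

lemma antipodal_antipodal: "antipodal (antipodal T) = T"
  by (simp add: antipodal_def fun_eq_iff)

lemma sphere_isometry_in: "sphere_isometry T \<Longrightarrow> x \<in> sphere 0 1 \<Longrightarrow> T x \<in> sphere 0 1"
  unfolding sphere_isometry_def by (metis imageI)

lemma sphere_isometry_preimage:
  assumes "sphere_isometry T" "y \<in> sphere 0 1"
  obtains x where "x \<in> sphere 0 1" "T x = y"
proof -
  have "y \<in> T ` sphere 0 1" using assms by (simp add: sphere_isometry_def)
  then show ?thesis using that by blast
qed

lemma sphere_isometry_dist: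
  "sphere_isometry T \<Longrightarrow> x \<in> sphere 0 1 \<Longrightarrow> y \<in> sphere 0 1 \<Longrightarrow> dist (T x) (T y) = dist x y"
  by (simp add: sphere_isometry_def)

lemma sphere_isometry_inj: "sphere_isometry T \<Longrightarrow> inj_on T (sphere 0 1)"
proof (rule inj_onI)
  fix x y assume "sphere_isometry T" "x \<in> sphere 0 1" "y \<in> sphere 0 1" "T x = T y"
  then show "x = y" using sphere_isometry_dist[of T x y] by simp
qed

lemma sphere_isometry_antipodal:
  assumes T: "sphere_isometry T"
  shows "sphere_isometry (antipodal T)"
proof -
  have neg: "- x \<in> sphere 0 1 \<longleftrightarrow> x \<in> sphere 0 1" for x :: "'c::real_normed_vector" by simp
  have "y \<in> antipodal T ` sphere 0 1" if y: "y \<in> sphere 0 1" for y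
  proof -
    obtain x where "x \<in> sphere 0 1" "T x = - y"
      using sphere_isometry_preimage[OF T] y neg by blast
    then show ?thesis by (intro image_eqI[of _ _ "- x"]) (auto simp: antipodal_def)
  qed
  moreover have "antipodal T x \<in> sphere 0 1" if "x \<in> sphere 0 1" for x
    using sphere_isometry_in[OF T, of "- x"] that by (simp add: antipodal_def)
  moreover have "dist (antipodal T x) (antipodal T y) = dist x y"
    if "x \<in> sphere 0 1" "y \<in> sphere 0 1" for x y
    using sphere_isometry_dist[OF T, of "- x" "- y"] that by (simp add: antipodal_def dist_minus)
  ultimately show ?thesis
    unfolding sphere_isometry_def by (intro conjI ballI subset_antisym subsetI) auto
qed

lemma sphere_isometry_inv_into:
  fixes T :: "'a::banach \<Rightarrow> 'b::banach"
  assumes T: "sphere_isometry T"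
  shows "sphere_isometry (inv_into (sphere 0 1) T)"
proof -
  have im: "T ` sphere 0 1 = sphere 0 1" using T by (simp add: sphere_isometry_def)
  then have "bij_betw T (sphere 0 1) (sphere 0 1)"
    using sphere_isometry_inj[OF T] by (simp add: bij_betw_def)
  then have "inv_into (sphere 0 1) T ` sphere 0 1 = sphere 0 1"
    using bij_betw_inv_into bij_betw_imp_surj_on by blast
  moreover have "dist (inv_into (sphere 0 1) T x) (inv_into (sphere 0 1) T y) = dist x y"
    if "x \<in> sphere 0 1" "y \<in> sphere 0 1" for x y
    using that sphere_isometry_dist[OF T, of "inv_into (sphere 0 1) T x" "inv_into (sphere 0 1) T y"]
      inv_into_into[of _ T "sphere 0 1"] f_inv_into_f[of _ T "sphere 0 1"] by (simp add: im)
  ultimately show ?thesis by (simp add: sphere_isometry_def)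
qed

lemma norm_add_isometry:
  assumes "sphere_isometry T" "a \<in> sphere 0 1" "y \<in> sphere 0 1"
  shows "norm (antipodal T a + T y) = norm (a + y)"
  using sphere_isometry_dist[OF assms(1), of y "- a"] assms(2,3)
  by (simp add: antipodal_def dist_norm add.commute)

lemma star_subset: "star A \<subseteq> sphere 0 1"
  by (auto simp: star_def)

text \<open>The antipodal image appears because \<open>T\<close> preserves the distance from \<open>y\<close> to \<open>- a\<close> and therefore
  replaces \<open>- a\<close> by \<open>T (- a)\<close>.\<close>

lemma isometry_star:
  assumes T: "sphere_isometry T" and A: "A \<subseteq> sphere 0 1"
  shows "T ` star A = star (antipodal T ` A)"
proof (intro set_eqI iffI)
  fix z assume "z \<in> T ` star A"
  then obtain y where y: "y \<in> star A" "z = T y" by blast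
  then have yS: "y \<in> sphere 0 1" using star_subset by blast
  have "norm (antipodal T a + T y) = 2" if "a \<in> A" for a
    using norm_add_isometry[OF T _ yS, of a] A that y(1) by (auto simp: star_def)
  then show "z \<in> star (antipodal T ` A)"
    using y(2) sphere_isometry_in[OF T yS] by (simp add: star_def)
next
  fix z assume z: "z \<in> star (antipodal T ` A)"
  then obtain y where y: "y \<in> sphere 0 1" "T y = z"
    using sphere_isometry_preimage[OF T] star_subset by blast
  have "norm (a + y) = 2" if "a \<in> A" for a
    using norm_add_isometry[OF T _ y(1), of a] A that z y(2) by (auto simp: star_def)
  then show "z \<in> T ` star A" using y by (auto simp: star_def)
qed

lemma maximal_convexD:
  assumes "F \<in> maximal_convex_subsets"
  shows "F \<subseteq> sphere 0 1" "convex F" "G \<subseteq> sphere 0 1 \<Longrightarrow> convex G \<Longrightarrow> F \<subseteq> G \<Longrightarrow> G = F"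
  using assms by (auto simp: maximal_convex_subsets_def)

lemma extend_to_maximal_convex:
  fixes C :: "'a::banach set"
  assumes C: "C \<subseteq> sphere 0 1" "convex C"
  shows "\<exists>K\<in>maximal_convex_subsets. C \<subseteq> K"
proof -
  let ?A = "{G. C \<subseteq> G \<and> G \<subseteq> sphere 0 1 \<and> convex G}"
  have "\<exists>M\<in>?A. \<forall>X\<in>?A. M \<subseteq> X \<longrightarrow> X = M"
  proof (rule subset_Zorn_nonempty)
    show "?A \<noteq> {}" using C by blast
  next
    fix \<C> assume ne: "\<C> \<noteq> {}" and ch: "subset.chain ?A \<C>"
    have sub: "\<C> \<subseteq> ?A" and lin: "\<And>X Y. X \<in> \<C> \<Longrightarrow> Y \<in> \<C> \<Longrightarrow> X \<subseteq> Y \<or> Y \<subseteq> X"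
      using ch by (auto simp: subset_chain_def)
    have "convex (\<Union>\<C>)"
    proof (rule convexI)
      fix x y and u v :: real
      assume xy: "x \<in> \<Union>\<C>" "y \<in> \<Union>\<C>" and uv: "0 \<le> u" "0 \<le> v" "u + v = 1"
      then obtain X Y where XY: "X \<in> \<C>" "Y \<in> \<C>" "x \<in> X" "y \<in> Y" by blast
      then obtain Z where Z: "Z \<in> \<C>" "x \<in> Z" "y \<in> Z" using lin by blast
      then have "convex Z" using sub by blast
      then show "u *\<^sub>R x + v *\<^sub>R y \<in> \<Union>\<C>" using Z uv convexD by blast
    qed
    then show "\<Union>\<C> \<in> ?A" using ne sub by blast
  qed
  then obtain M where "M \<in> ?A" and max: "\<forall>X\<in>?A. M \<subseteq> X \<longrightarrow> X = M" ..
  then have M: "C \<subseteq> M" "M \<subseteq> sphere 0 1" "convex M" by simp_all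
  have "G = M" if "G \<subseteq> sphere 0 1" "convex G" "M \<subseteq> G" for G
    using max[rule_format, of G] that M(1) by simp
  then have "M \<in> maximal_convex_subsets"
    using M unfolding maximal_convex_subsets_def by simp
  then show ?thesis using M(1) by (rule bexI[rotated])
qed

lemma level_set_convex:
  assumes q: "norm q \<le> 1"
  shows "convex (level_set q 1)"
proof (rule convexI)
  fix x y and u v :: real
  assume x: "x \<in> level_set q 1" and y: "y \<in> level_set q 1" and uv: "0 \<le> u" "0 \<le> v" "u + v = 1"
  let ?z = "u *\<^sub>R x + v *\<^sub>R y"
  have qz: "blinfun_apply q ?z = 1"
    using x y uv by (simp add: level_set_def blinfun.add_right blinfun.scaleR_right)
  have "norm ?z \<le> norm (u *\<^sub>R x) + norm (v *\<^sub>R y)" by (rule norm_triangle_ineq)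
  also have "\<dots> = 1" using x y uv by (simp add: level_set_def)
  finally have "norm ?z \<le> 1" .
  moreover have "norm (blinfun_apply q ?z) \<le> norm ?z"
    using norm_blinfun[of q ?z] mult_right_mono[OF q, of "norm ?z"] by simp
  ultimately show "?z \<in> level_set q 1" using qz by (simp add: level_set_def)
qed

lemma maximal_convex_nonempty:
  fixes F :: "'a::banach set"
  assumes "F \<in> maximal_convex_subsets" "(x :: 'a) \<in> sphere 0 1"
  shows "F \<noteq> {}"
proof
  assume "F = {}"
  then have "{x} = F" using assms(2) by (intro maximal_convexD(3)[OF assms(1)]) auto
  then show False using \<open>F = {}\<close> by simp
qed

lemma maximal_convex_eq_level_set:
  fixes F :: "'a::banach set"
  assumes F: "F \<in> maximal_convex_subsets" "F \<noteq> {}"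
  shows "\<exists>q. q extreme_point_of cball 0 1 \<and> F = level_set q 1"
proof -
  obtain q :: "'a \<Rightarrow>\<^sub>L real" where q: "q extreme_point_of cball 0 1" "\<forall>a\<in>F. blinfun_apply q a = 1"
    using extreme_supporting_functional[OF maximal_convexD(2)[OF F(1)] F(2) maximal_convexD(1)[OF F(1)]]
    by auto
  then have "norm q \<le> 1" by (simp add: extreme_point_of_def)
  moreover have "F \<subseteq> level_set q 1"
    using q maximal_convexD(1)[OF F(1)] by (auto simp: level_set_def)
  ultimately have "level_set q 1 = F"
    by (intro maximal_convexD(3)[OF F(1)] level_set_convex) (auto simp: level_set_def)
  then show ?thesis using q(1) by blast
qed

text \<open>The two points \<open>u a + v y\<close> and \<open>v a + u y\<close> of the unit ball add up to \<open>a + y\<close>, which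
  has norm \<open>2\<close>; neither can be shorter than \<open>1\<close>.\<close>

lemma norm_segment_eq_one:
  fixes a y :: "'a::real_normed_vector"
  assumes "norm a = 1" "norm y = 1" "norm (a + y) = 2" "0 \<le> u" "0 \<le> v" "u + v = 1"
  shows "norm (u *\<^sub>R a + v *\<^sub>R y) = 1"
proof -
  let ?z = "u *\<^sub>R a + v *\<^sub>R y"
  have v: "v = 1 - u" using assms by simp
  have "norm (a + y) \<le> norm ?z + norm (v *\<^sub>R a + u *\<^sub>R y)"
    by (rule order_trans[OF _ norm_triangle_ineq]) (simp add: v algebra_simps)
  moreover have "norm (v *\<^sub>R a + u *\<^sub>R y) \<le> norm (v *\<^sub>R a) + norm (u *\<^sub>R y)"
    by (rule norm_triangle_ineq)
  moreover have "norm ?z \<le> norm (u *\<^sub>R a) + norm (v *\<^sub>R y)" by (rule norm_triangle_ineq)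
  ultimately show ?thesis using assms by simp
qed

lemma convex_subset_star:
  assumes K: "convex K" "K \<subseteq> sphere 0 1" and w: "w \<in> K"
  shows "K \<subseteq> star {w}"
proof
  fix k assume k: "k \<in> K"
  have "(1/2) *\<^sub>R w + (1/2) *\<^sub>R k \<in> K" using K w k by (intro convexD) auto
  then have "norm ((1/2) *\<^sub>R (w + k)) = 1" using K(2) by (auto simp: scaleR_add_right)
  then have "norm (w + k) = 2" by (simp del: scaleR_half_double)
  then show "k \<in> star {w}" using K(2) k by (auto simp: star_def)
qed

text \<open>A point \<open>y\<close> of the star is joined to every point of \<open>F\<close> by a segment in the sphere. As \<open>F\<close> is convex,
  these segments fill the convex hull of \<open>F\<close> and \<open>y\<close>, so by maximality \<open>y\<close> was already in \<open>F\<close>.\<close>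

lemma star_maximal_convex:
  fixes F :: "'a::banach set"
  assumes F: "F \<in> maximal_convex_subsets"
  shows "star F = F"
proof
  note FS = maximal_convexD(1,2)[OF F]
  show "F \<subseteq> star F"
    using convex_subset_star[OF FS(2,1)] by (auto simp: star_def)
  show "star F \<subseteq> F"
  proof
    fix y assume y: "y \<in> star F"
    show "y \<in> F"
    proof (cases "F = {}")
      case True
      then show ?thesis using y maximal_convex_nonempty[OF F, of y] star_subset by blast
    next
      case False
      note eq = convex_hull_insert[OF False, of y, unfolded hull_same[of convex F, OF FS(2)]]
      have "convex hull (insert y F) \<subseteq> sphere 0 1"
      proof
        fix z assume "z \<in> convex hull (insert y F)"
        then obtain u v b where z: "z = u *\<^sub>R y + v *\<^sub>R b" "0 \<le> u" "0 \<le> v" "u + v = 1" "b \<in> F"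
          unfolding eq by blast
        have "norm (y + b) = 2" using y z(5) by (simp add: star_def add.commute)
        then have "norm z = 1"
          unfolding z(1) using z y FS(1) by (intro norm_segment_eq_one) (auto simp: star_def)
        then show "z \<in> sphere 0 1" by simp
      qed
      then have "convex hull (insert y F) = F"
        by (intro maximal_convexD(3)[OF F]) (auto intro: hull_inc)
      then show ?thesis using hull_inc[of y "insert y F"] by auto
    qed
  qed
qed

text \<open>If the average of unit vectors is in the star position to \<open>y\<close>, then so is each of the vectors: the
  numbers \<open>norm (x + y)\<close> are at most \<open>2\<close> and have average at least \<open>2\<close>.\<close>

lemma norm_add_average:
  fixes X :: "'a::real_normed_vector set"
  assumes X: "finite X" "X \<subseteq> sphere 0 1" and y: "norm y = 1"
    and av: "norm ((\<Sum>x\<in>X. (1 / card X) *\<^sub>R x) + y) = 2" and x: "x \<in> X"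
  shows "norm (x + y) = 2"
proof -
  have le: "norm (z + y) \<le> 2" if "z \<in> X" for z
    using norm_triangle_ineq[of z y] X(2) y that by auto
  have n: "card X > 0" using X x by (auto simp: card_gt_0_iff)
  have "(\<Sum>z\<in>X. z + y) = card X *\<^sub>R ((\<Sum>x\<in>X. (1 / card X) *\<^sub>R x) + y)"
    using n by (simp add: sum.distrib scaleR_add_right scaleR_sum_right sum_constant_scaleR)
  then have "norm (\<Sum>z\<in>X. z + y) = card X * 2"
    using av by simp
  then have "card X * 2 \<le> (\<Sum>z\<in>X. norm (z + y))"
    using norm_sum[of "\<lambda>z. z + y" X] by simp
  moreover have "(\<Sum>z\<in>X. norm (z + y)) < (\<Sum>z\<in>X. 2)" if "norm (x + y) < 2"
    using X le x that by (intro sum_strict_mono_ex1) auto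
  ultimately have "\<not> norm (x + y) < 2" by (auto simp: mult.commute)
  then show ?thesis using le[OF x] by simp
qed

text \<open>The heart of the matter: a metric reason for finitely many image points to lie in one convex
  subset of the sphere. Let \<open>x0\<close> be the average of \<open>X\<close>, let \<open>K\<close> be a maximal convex set containing
  \<open>T x0\<close>, and let \<open>R\<close> be the preimage of \<open>K\<close> under the antipodal isometry. Since \<open>K\<close> lies in the star
  of \<open>T x0\<close>, the set \<open>R\<close> lies in the star of \<open>x0\<close>; by the averaging argument each point of \<open>X\<close> is
  then in the star of \<open>R\<close>. Applying \<open>T\<close>, each point of \<open>T ` X\<close> is in the star of \<open>K\<close>, which is \<open>K\<close>.\<close>

lemma finite_image_in_maximal_convex:
  fixes T :: "'a::banach \<Rightarrow> 'b::banach"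
  assumes T: "sphere_isometry T" and F: "convex F" "F \<subseteq> sphere 0 1"
    and X: "finite X" "X \<subseteq> F" "X \<noteq> {}"
  shows "\<exists>K\<in>maximal_convex_subsets. T ` X \<subseteq> K"
proof -
  let ?U = "antipodal T"
  note U = sphere_isometry_antipodal[OF T]
  define x0 where "x0 = (\<Sum>x\<in>X. (1 / card X) *\<^sub>R x)"
  have "x0 \<in> F"
    unfolding x0_def using X by (intro convex_sum F) auto
  then have x0: "x0 \<in> sphere 0 1" using F by blast
  have XS: "X \<subseteq> sphere 0 1" using X F by blast
  obtain K where K: "K \<in> maximal_convex_subsets" "T x0 \<in> K"
    using extend_to_maximal_convex[of "{T x0}"] sphere_isometry_in[OF T x0] by auto
  define R where "R = {x \<in> sphere 0 1. ?U x \<in> K}"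
  have UR: "?U ` R = K"
  proof
    show "K \<subseteq> ?U ` R"
    proof
      fix y assume y: "y \<in> K"
      then obtain x where "x \<in> sphere 0 1" "?U x = y"
        using sphere_isometry_preimage[OF U] maximal_convexD(1)[OF K(1)] by blast
      then show "y \<in> ?U ` R" using y by (auto simp: R_def)
    qed
  qed (auto simp: R_def)
  have "K \<subseteq> star {T x0}"
    using convex_subset_star K maximal_convexD(1,2)[OF K(1)] by blast
  also have "\<dots> = ?U ` star {x0}"
    using isometry_star[OF U, of "{x0}"] x0 by (simp add: antipodal_antipodal)
  finally have R: "R \<subseteq> star {x0}"
    using sphere_isometry_inj[OF U] star_subset[of "{x0}"]
    unfolding R_def inj_on_def by blast
  have "X \<subseteq> star R"
  proof
    fix x assume x: "x \<in> X"
    have "norm (r + x) = 2" if "r \<in> R" for r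
      using norm_add_average[OF X(1) XS, of r x] R that x
      by (auto simp: star_def x0_def add.commute)
    then show "x \<in> star R" using x XS by (auto simp: star_def)
  qed
  then have "T ` X \<subseteq> T ` star R" by (rule image_mono)
  also have "\<dots> = star (?U ` R)"
    by (rule isometry_star[OF T]) (auto simp: R_def)
  also have "\<dots> = K" using UR star_maximal_convex[OF K(1)] by simp
  finally show ?thesis using K(1) by blast
qed

text \<open>A point of the convex hull of the image involves only finitely many image points, so the hull stays in
  the sphere.\<close>

lemma image_in_maximal_convex:
  fixes T :: "'a::banach \<Rightarrow> 'b::banach"
  assumes T: "sphere_isometry T" and F: "convex F" "F \<subseteq> sphere 0 1"
  shows "\<exists>K\<in>maximal_convex_subsets. T ` F \<subseteq> K"
proof -
  have "convex hull (T ` F) \<subseteq> sphere 0 1"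
  proof
    fix z assume "z \<in> convex hull (T ` F)"
    then obtain Y u where Y: "finite Y" "Y \<subseteq> T ` F" "\<forall>x\<in>Y. 0 \<le> u x" "sum u Y = 1"
        "(\<Sum>v\<in>Y. u v *\<^sub>R v) = z"
      unfolding convex_hull_explicit by auto
    obtain X where X: "finite X" "X \<subseteq> F" "Y = T ` X"
      using finite_subset_image[OF Y(1,2)] by auto
    have "X \<noteq> {}" using X Y by auto
    then obtain K where K: "K \<in> maximal_convex_subsets" "Y \<subseteq> K"
      using finite_image_in_maximal_convex[OF T F] X by blast
    have "z \<in> K"
      unfolding Y(5)[symmetric] using Y K
      by (intro convex_sum maximal_convexD(2)[OF K(1)]) auto
    then show "z \<in> sphere 0 1" using maximal_convexD(1)[OF K(1)] by blast
  qed
  then obtain K where "K \<in> maximal_convex_subsets" "convex hull (T ` F) \<subseteq> K"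
    using extend_to_maximal_convex convex_convex_hull by blast
  then show ?thesis using hull_subset[of "T ` F" convex] by blast
qed

text \<open>The inverse isometry sends a maximal convex set containing \<open>T ` F\<close> into a convex set containing \<open>F\<close>;
  maximality of \<open>F\<close> closes the circle.\<close>

theorem image_maximal_convex:
  fixes T :: "'a::banach \<Rightarrow> 'b::banach"
  assumes T: "sphere_isometry T" and F: "F \<in> maximal_convex_subsets"
  shows "T ` F \<in> maximal_convex_subsets"
proof -
  let ?V = "inv_into (sphere 0 1) T"
  note FS = maximal_convexD(1,2)[OF F]
  have im: "T ` sphere 0 1 = sphere 0 1" using T by (simp add: sphere_isometry_def)
  obtain K where K: "K \<in> maximal_convex_subsets" "T ` F \<subseteq> K"
    using image_in_maximal_convex[OF T FS(2,1)] by blast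
  note KS = maximal_convexD(1,2)[OF K(1)]
  obtain G where G: "G \<in> maximal_convex_subsets" "?V ` K \<subseteq> G"
    using image_in_maximal_convex[OF sphere_isometry_inv_into[OF T] KS(2,1)] by blast
  have "F \<subseteq> ?V ` K"
  proof
    fix x assume x: "x \<in> F"
    then have "?V (T x) = x"
      using sphere_isometry_inj[OF T] FS(1) by (auto intro!: inv_into_f_f)
    then show "x \<in> ?V ` K" using x K(2) by (metis image_eqI image_subset_iff)
  qed
  then have "G = F"
    using G maximal_convexD(1,2)[OF G(1)] by (intro maximal_convexD(3)[OF F]) auto
  have "K \<subseteq> T ` F"
  proof
    fix y assume y: "y \<in> K"
    then have "T (?V y) = y" using KS(1) im by (intro f_inv_into_f) auto
    then show "y \<in> T ` F" using y G(2) \<open>G = F\<close> by (metis image_eqI image_subset_iff)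
  qed
  then have "T ` F = K" using K(2) by blast
  then show ?thesis using K(1) by simp
qed

text \<open>Equivalently \<open>T ` (- F) = - T ` F\<close>. Both images are maximal convex, hence equal to their
  stars, while \<open>T\<close> maps the star of \<open>F\<close> onto the star of the antipodal image.\<close>

theorem image_antipodal_maximal_convex:
  fixes T :: "'a::banach \<Rightarrow> 'b::banach"
  assumes T: "sphere_isometry T" and F: "F \<in> maximal_convex_subsets"
  shows "antipodal T ` F = T ` F"
proof -
  have "T ` F = T ` star F" using star_maximal_convex[OF F] by simp
  also have "\<dots> = star (antipodal T ` F)"
    using isometry_star[OF T maximal_convexD(1)[OF F]] .
  also have "\<dots> = antipodal T ` F"
    using star_maximal_convex image_maximal_convex[OF sphere_isometry_antipodal[OF T] F] by blast
  finally show ?thesis by simp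
qed


section \<open>Extension of the isometry\<close>

lemma level_set_minus: "level_set q (- c) = uminus ` level_set q c"
proof -
  have "a \<in> uminus ` level_set q c" if "a \<in> level_set q (- c)" for a
    using that by (intro image_eqI[of _ _ "- a"]) (auto simp: level_set_def blinfun.minus_right)
  then show ?thesis by (auto simp: level_set_def blinfun.minus_right)
qed

lemma phase_cases: "phase \<alpha> = 1 \<and> 0 \<le> \<alpha> \<or> phase \<alpha> = - 1 \<and> \<alpha> \<le> 0"
  by (auto simp: phase_def abs_if)

lemma infdist_isometry_image:
  assumes "\<And>y. y \<in> A \<Longrightarrow> dist (T x) (T y) = dist x y"
  shows "infdist (T x) (T ` A) = infdist x A"
  using assms by (simp add: infdist_def image_image cong: image_cong_simp)

lemma abs_diff_le_infdist_level_set: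
  assumes q: "norm q \<le> 1" and ne: "level_set q c \<noteq> {}"
  shows "\<bar>blinfun_apply q a - c\<bar> \<le> infdist a (level_set q c)"
proof -
  have "\<bar>blinfun_apply q a - c\<bar> \<le> dist a b" if b: "b \<in> level_set q c" for b
  proof -
    have "norm (blinfun_apply q (a - b)) \<le> norm (a - b)"
      using norm_blinfun[of q "a - b"] mult_right_mono[OF q, of "norm (a - b)"] by simp
    then show ?thesis using b by (simp add: level_set_def blinfun.diff_right dist_norm)
  qed
  then show ?thesis
    using ne by (auto simp: infdist_notempty intro!: cINF_greatest)
qed

text \<open>The distances to the faces where \<open>q = 1\<close> and \<open>q = - 1\<close> bound \<open>q a\<close> from both sides, and the two
  bounds coincide. So in any space a point satisfying the two distance conditions lies on the right
  level of \<open>q\<close>.\<close>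

lemma apply_eq_of_infdist:
  assumes q: "norm q \<le> 1" and ne: "level_set q 1 \<noteq> {}"
    and "infdist a (level_set q (phase \<alpha>)) \<le> 1 - \<bar>\<alpha>\<bar>"
    and "infdist a (level_set q (- phase \<alpha>)) \<le> 1 + \<bar>\<alpha>\<bar>"
  shows "blinfun_apply q a = \<alpha>"
proof -
  have "level_set q (- 1) \<noteq> {}" using ne by (simp add: level_set_minus)
  then have "level_set q (phase \<alpha>) \<noteq> {}" "level_set q (- phase \<alpha>) \<noteq> {}"
    using ne phase_cases[of \<alpha>] by auto
  then have "\<bar>blinfun_apply q a - phase \<alpha>\<bar> \<le> 1 - \<bar>\<alpha>\<bar>" "\<bar>blinfun_apply q a - - phase \<alpha>\<bar> \<le> 1 + \<bar>\<alpha>\<bar>"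
    using assms abs_diff_le_infdist_level_set[OF q] order_trans by blast+
  then show ?thesis using phase_cases[of \<alpha>] by auto
qed

text \<open>A maximal convex set containing \<open>x\<close> is cut out by an extreme functional, which can be exchanged for
  an element of \<open>P\<close> up to sign.\<close>

lemma representatives_norming:
  fixes P :: "('a::banach \<Rightarrow>\<^sub>L real) set"
  assumes P: "representatives P" and x: "x \<in> sphere 0 1"
  shows "\<exists>p\<in>P. \<bar>blinfun_apply p x\<bar> = 1"
proof -
  obtain F where F: "F \<in> maximal_convex_subsets" "x \<in> F"
    using extend_to_maximal_convex[of "{x}"] x by auto
  then obtain q where q: "q extreme_point_of cball 0 1" "F = level_set q 1"
    using maximal_convex_eq_level_set by blast
  then have qQ: "q \<in> Q_set" using F(1) by (simp add: Q_set_def)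
  then have "Q_rel `` {q} \<in> Q_set // Q_rel" by (rule quotientI)
  then obtain p where p: "p \<in> P" "(q, p) \<in> Q_rel"
    using P unfolding representatives_def by blast
  then obtain \<gamma> where "\<gamma> \<in> {1, - 1::real}" "level_set q 1 = level_set (\<gamma> *\<^sub>R p) 1"
    unfolding Q_rel_def by blast
  then have "\<bar>\<gamma>\<bar> = 1" "\<gamma> * p x = 1"
    using F(2) q(2) by (auto simp: level_set_def blinfun.scaleR_left)
  then show ?thesis using p(1) by (metis abs_mult abs_one mult_1)
qed

text \<open>The image of the face \<open>p = 1\<close> is a maximal convex set, hence the face \<open>q = 1\<close> of some \<open>q\<close> of norm at most \<open>1\<close>,
  and the opposite faces correspond as well. The hypothesis bounds
  the distances of a point on a level of \<open>p\<close> to the two faces; the bounds are preserved, and in the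
  target they determine the value of \<open>q\<close>.\<close>

lemma transported_functional:
  fixes T :: "'a::banach \<Rightarrow> 'b::banach"
  assumes T: "sphere_isometry T" and p: "p \<in> Q_set"
    and M: "\<And>\<alpha>. - 1 \<le> \<alpha> \<Longrightarrow> \<alpha> \<le> 1 \<Longrightarrow> level_set p \<alpha> \<subseteq> M_set p \<alpha>"
  shows "\<exists>q. \<forall>a\<in>sphere 0 1. blinfun_apply q (T a) = blinfun_apply p a"
proof (cases "sphere 0 1 = ({} :: 'a set)")
  case True then show ?thesis by simp
next
  case False
  let ?F = "level_set p 1"
  have F: "?F \<in> maximal_convex_subsets" and p1: "norm p \<le> 1"
    using p by (auto simp: Q_set_def extreme_point_of_def)
  have ne: "?F \<noteq> {}" using maximal_convex_nonempty[OF F] False by blast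
  have TF: "T ` ?F \<in> maximal_convex_subsets" by (rule image_maximal_convex[OF T F])
  then obtain q where q: "q extreme_point_of cball 0 1" "T ` ?F = level_set q 1"
    using maximal_convex_eq_level_set ne by blast
  have q1: "norm q \<le> 1" using q(1) by (simp add: extreme_point_of_def)
  have qne: "level_set q 1 \<noteq> {}" using q(2) ne by auto
  have "T ` level_set p (- 1) = uminus ` antipodal T ` ?F"
    by (simp add: level_set_minus image_image antipodal_def)
  then have q': "T ` level_set p (- 1) = level_set q (- 1)"
    using image_antipodal_maximal_convex[OF T F] q(2) by (simp add: level_set_minus[of q])
  have im: "T ` level_set p c = level_set q c" if "c = 1 \<or> c = - 1" for c
    using that q(2) q' by auto
  have "q (T a) = p a" if a: "a \<in> sphere 0 1" for a
  proof -
    define \<alpha> where "\<alpha> = p a"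
    have "norm (p a) \<le> 1"
      using norm_blinfun[of p a] p1 a by simp
    then have "a \<in> M_set p \<alpha>"
      using M[of \<alpha>] a by (auto simp: level_set_def \<alpha>_def abs_le_iff)
    moreover have "infdist (T a) (level_set q c) = infdist a (level_set p c)" if "c = 1 \<or> c = - 1" for c
      unfolding im[OF that, symmetric] using a
      by (intro infdist_isometry_image sphere_isometry_dist[OF T]) (auto simp: level_set_def)
    ultimately have "q (T a) = \<alpha>"
      using phase_cases[of \<alpha>] by (intro apply_eq_of_infdist[OF q1 qne]) (auto simp: M_set_def)
    then show ?thesis by (simp add: \<alpha>_def)
  qed
  then show ?thesis by blast
qed

definition radial_extension :: "('a::real_normed_vector \<Rightarrow> 'b::real_normed_vector) \<Rightarrow> 'a \<Rightarrow> 'b"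
  where "radial_extension T x = norm x *\<^sub>R T (x /\<^sub>R norm x)"

lemma radial_extension_apply:
  assumes "\<forall>a\<in>sphere 0 1. blinfun_apply q (T a) = blinfun_apply p a"
  shows "blinfun_apply q (radial_extension T x) = blinfun_apply p x"
proof (cases "x = 0")
  case False
  then have "q (T (x /\<^sub>R norm x)) = p (x /\<^sub>R norm x)" using assms by simp
  then show ?thesis using False by (simp add: radial_extension_def blinfun.scaleR_right)
qed (simp add: radial_extension_def)

lemma norm_radial_extension:
  "sphere_isometry T \<Longrightarrow> norm (radial_extension T x) = norm x"
  using sphere_isometry_in[of T "x /\<^sub>R norm x"] by (cases "x = 0") (auto simp: radial_extension_def)

lemma surj_radial_extension:
  assumes T: "sphere_isometry T"
  shows "surj (radial_extension T)"
proof (rule surjI)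
  fix y
  show "radial_extension T (if y = 0 then 0 else norm y *\<^sub>R inv_into (sphere 0 1) T (y /\<^sub>R norm y)) = y"
  proof (cases "y = 0")
    case False
    define x where "x = inv_into (sphere 0 1) T (y /\<^sub>R norm y)"
    have im: "y /\<^sub>R norm y \<in> T ` sphere 0 1"
      using T False by (simp add: sphere_isometry_def)
    then have "x \<in> sphere 0 1" "T x = y /\<^sub>R norm y"
      unfolding x_def by (blast intro: inv_into_into f_inv_into_f)+
    then show ?thesis using False by (simp add: radial_extension_def flip: x_def)
  qed (simp add: radial_extension_def)
qed

theorem proposition4p11:
  fixes P :: "('a::banach \<Rightarrow>\<^sub>L real) set"
  assumes "representatives P"
    and "\<And>p \<alpha>. p \<in> P \<Longrightarrow> -1 \<le> \<alpha> \<Longrightarrow> \<alpha> \<le> 1 \<Longrightarrow>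
           M_set p \<alpha> = {a \<in> sphere 0 1. blinfun_apply p a = \<alpha>}"
  shows "mazur_ulam_property TYPE('a) TYPE('b::banach)"
  unfolding mazur_ulam_property_def
proof (intro allI impI)
  fix T :: "'a \<Rightarrow> 'b"
  assume "T ` sphere 0 1 = sphere 0 1 \<and>
      (\<forall>x \<in> sphere 0 1. \<forall>y \<in> sphere 0 1. dist (T x) (T y) = dist x y)"
  then have T: "sphere_isometry T" by (simp add: sphere_isometry_def)
  let ?L = "radial_extension T"
  have "\<exists>q. \<forall>x. blinfun_apply q (?L x) = blinfun_apply p x" if p: "p \<in> P" for p
  proof -
    have "p \<in> Q_set" using assms(1) p by (auto simp: representatives_def)
    then obtain q where "\<forall>a\<in>sphere 0 1. blinfun_apply q (T a) = blinfun_apply p a"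
      using transported_functional[OF T, of p] assms(2)[OF p] by (auto simp: level_set_def)
    then show ?thesis using radial_extension_apply by blast
  qed
  then obtain q where q: "\<And>p x. p \<in> P \<Longrightarrow> blinfun_apply (q p) (?L x) = blinfun_apply p x"
    by metis
  \<comment> \<open>The transported functionals are total: every nonzero vector is a multiple of some image of a unit vector, where one of them takes the value \<open>\<plusminus>1\<close>.\<close>
  have separate: "z = 0" if z: "\<And>p. p \<in> P \<Longrightarrow> blinfun_apply (q p) z = 0" for z
  proof (rule ccontr)
    assume "z \<noteq> 0"
    obtain x where x: "z = ?L x" using surj_radial_extension[OF T] by (metis surjD)
    then have "x \<noteq> 0" using \<open>z \<noteq> 0\<close> norm_radial_extension[OF T, of x] by auto
    then obtain p where p: "p \<in> P" "\<bar>blinfun_apply p (x /\<^sub>R norm x)\<bar> = 1"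
      using representatives_norming[OF assms(1), of "x /\<^sub>R norm x"] by auto
    then have "blinfun_apply p x \<noteq> 0" by (auto simp: blinfun.scaleR_right)
    then show False using z[OF p(1)] q[OF p(1)] x by simp
  qed
  have lin: "linear ?L"
  proof (rule linearI)
    fix x y
    have "?L (x + y) - (?L x + ?L y) = 0"
      by (rule separate) (simp add: blinfun.diff_right blinfun.add_right q)
    then show "?L (x + y) = ?L x + ?L y" by simp
  next
    fix c x
    have "?L (c *\<^sub>R x) - c *\<^sub>R ?L x = 0"
      by (rule separate) (simp add: blinfun.diff_right blinfun.scaleR_right q)
    then show "?L (c *\<^sub>R x) = c *\<^sub>R ?L x" by simp
  qed
  moreover have "dist (?L x) (?L y) = dist x y" for x y
    using norm_radial_extension[OF T, of "x - y"] linear_diff[OF lin] by (simp add: dist_norm)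
  moreover have "?L x = T x" if "x \<in> sphere 0 1" for x
    using that by (simp add: radial_extension_def)
  ultimately show "\<exists>L :: 'a \<Rightarrow> 'b. linear L \<and> surj L \<and> (\<forall>x y. dist (L x) (L y) = dist x y) \<and>
        (\<forall>x \<in> sphere 0 1. L x = T x)"
    using surj_radial_extension[OF T] by blast
qed

end
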